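(* Let $n\ge1$ be an integer and let $1=c_1<c_2<\cdots<c_{d-1}<c_d=n$ be the divisors of $n$. For $1\le\ell\le d$ let $M_\ell=\{t\frac{n}{c_\ell}:0\le t<c_\ell\}$ and define $\mathbf{r}^{(\ell)}=(r^{(\ell)}_{ij})\in\mathbb{R}^{n\times n}$ by $$r_{ij}^{(\ell)}=\begin{cases}1,&\text{if }i\in M_\ell\text{ and }j=c_\ell,\\0,&\text{otherwise.}\end{cases}$$ Then the extreme rays of the universal CSP cone $\widetilde{\mathrm{CSP}}(n)$ are (up to positive scalar multiples) given by $\{\mathbf{r}^{(\ell)}:1\le\ell\le d\}$.
   Context: Rows of $n\times n$ matrices are indexed by $i=0,\dots,n-1$ and columns by $j=1,\dots,n$. Let $\omega_n$ be a primitive $n$-th root of unity. A matrix $A=(a_{ij})\in\mathbb{R}_{\ge 0}^{n\times n}$ is a CSP-matrix if for each $1\le k\le n$, $\sum_{0\le i<n,\,1\le j\le n}a_{ij}\,\omega_n^{ki}=\sum_{0\le i<n}\sum_{j\mid k}a_{ij}$; $\mathrm{CSP}(n)$ is the set of all such matrices. A matrix $A\in\mathrm{CSP}(n)$ is universal if there are constants $K_1,\dots,K_n\ge0$ such that $a_{ij}=K_j$ if $i\equiv0\pmod{n/j}$ and $a_{ij}=0$ otherwise (columns $j\nmid n$ of a CSP-matrix are zero, so this is a condition on the columns $j\mid n$). $\widetilde{\mathrm{CSP}}(n)$ is the subcone of universal CSP-matrices. Extreme rays of a polyhedral cone that are positive multiples of each other are regarded as equivalent. *)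

theory Defs
  imports Complex_Main "Jordan_Normal_Form.Matrix"
begin

definition primitive_root_of_unity :: "nat \<Rightarrow> complex \<Rightarrow> bool" where
  "primitive_root_of_unity n \<omega> \<longleftrightarrow> \<omega> ^ n = 1 \<and> (\<forall>k. 0 < k \<and> k < n \<longrightarrow> \<omega> ^ k \<noteq> 1)"

(* Rows are indexed by 0, ..., n-1 but columns by 1, ..., n, whereas library matrices use 0-based
   indices for both.  Only columns j \<ge> 1 are ever accessed, so j - 1 does not truncate. *)
definition entry :: "real mat \<Rightarrow> nat \<Rightarrow> nat \<Rightarrow> real" where
  "entry A i j = A $$ (i, j - 1)"

definition CSP :: "complex \<Rightarrow> nat \<Rightarrow> real mat set" where
  "CSP \<omega> n = {A \<in> carrier_mat n n.
     (\<forall>i<n. \<forall>j\<in>{1..n}. entry A i j \<ge> 0) \<and>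
     (\<forall>k\<in>{1..n}.
        (\<Sum>i<n. \<Sum>j\<in>{1..n}. complex_of_real (entry A i j) * \<omega> ^ (k * i)) =
        complex_of_real (\<Sum>i<n. \<Sum>j\<in>{j\<in>{1..n}. j dvd k}. entry A i j))}"

(* The shape is prescribed only for columns j dividing n: n/j must be an integer, and the other
   columns of a CSP-matrix are zero anyway (compare the CSP identity for k = n with the
   nonnegativity of the entries). *)
definition universal_CSP :: "complex \<Rightarrow> nat \<Rightarrow> real mat set" where
  "universal_CSP \<omega> n = {A \<in> CSP \<omega> n.
     \<exists>K :: nat \<Rightarrow> real. (\<forall>j\<in>{1..n}. K j \<ge> 0) \<and>
       (\<forall>i<n. \<forall>j\<in>{1..n}. j dvd n \<longrightarrow>
          entry A i j = (if (n div j) dvd i then K j else 0))}"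

(* X generates an extreme ray of the cone C, i.e. a one-dimensional face: X is nonzero and every
   decomposition of X inside C consists of nonnegative multiples of X. *)
definition extreme_ray :: "real mat set \<Rightarrow> real mat \<Rightarrow> bool" where
  "extreme_ray C X \<longleftrightarrow> X \<in> C \<and> X \<noteq> 0\<^sub>m (dim_row X) (dim_col X) \<and>
     (\<forall>Y\<in>C. \<forall>Z\<in>C. X = Y + Z \<longrightarrow>
        (\<exists>s\<ge>0. Y = s \<cdot>\<^sub>m X) \<and> (\<exists>t\<ge>0. Z = t \<cdot>\<^sub>m X))"

definition M_set :: "nat \<Rightarrow> nat \<Rightarrow> nat set" where
  "M_set n c = {t * (n div c) | t. t < c}"

(* The matrix r^(l) for c = c_l; the stored column index j corresponds to column j + 1. *)
definition r_mat :: "nat \<Rightarrow> nat \<Rightarrow> real mat" where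
  "r_mat n c = mat n n (\<lambda>(i, j). if i \<in> M_set n c \<and> j + 1 = c then 1 else 0)"

end

theory Submission
  imports Defs
begin

text \<open>
  A universal CSP-matrix is determined by its constants \<open>K j\<close> for the divisors \<open>j\<close> of \<open>n\<close>, and the
  theorem says that these constants can be chosen freely: the cone is a nonnegative orthant with one
  coordinate for each divisor, and the matrices \<open>r_mat n j\<close> are its unit vectors.  The extreme rays
  of an orthant are its coordinate axes.

  The identification with the orthant (\<open>universal_CSP_iff\<close>) has two halves.  The columns that are
  not indexed by divisors vanish, because the CSP identity for \<open>k = n\<close> says that they contribute
  nothing to the sum of all the entries, which are nonnegative.  Conversely, the CSP identity is
  linear in the matrix, so it suffices to consider a single divisor \<open>j\<close>; there
  it says that the \<open>j\<close> multiples of \<open>n div j\<close> below \<open>n\<close> satisfy the cyclic sieving relation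
  (\<open>sum_root_powers_over_multiples\<close>), which is a geometric sum.
\<close>

section \<open>Cyclic sieving on a single column\<close>

lemma primitive_root_power_eq_1_iff:
  assumes "n \<ge> 1" and "primitive_root_of_unity n \<omega>"
  shows "\<omega> ^ m = 1 \<longleftrightarrow> n dvd m"
proof -
  have "\<omega> ^ m = \<omega> ^ (n * (m div n) + m mod n)" by simp
  also have "\<dots> = \<omega> ^ (m mod n)"
    using assms(2) unfolding power_add power_mult primitive_root_of_unity_def by simp
  finally have "\<omega> ^ m = \<omega> ^ (m mod n)" .
  moreover have "m mod n < n" using assms(1) by simp
  ultimately show ?thesis
    using assms(2) unfolding primitive_root_of_unity_def
    by (metis dvd_eq_mod_eq_0 gr0I power_0)
qed

lemma multiples_below:
  fixes n j :: nat
  assumes "n \<ge> 1" and "j dvd n"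
  shows "{i. i < n \<and> n div j dvd i} = (\<lambda>t. t * (n div j)) ` {..<j}"
proof -
  obtain q where q: "n = j * q" using assms(2) by blast
  with assms(1) have "j > 0" "q > 0" by auto
  with q show ?thesis by (auto simp: dvd_def mult.commute)
qed

lemma M_set_eq_multiples:
  assumes "n \<ge> 1" and "j dvd n"
  shows "M_set n j = {i. i < n \<and> n div j dvd i}"
  using multiples_below[OF assms] by (auto simp: M_set_def)

text \<open>
  As \<open>i\<close> runs over the multiples of \<open>n div j\<close>, \<open>\<omega> ^ (k * i)\<close> runs over the powers of the \<open>j\<close>-th root of unity
  \<open>\<omega> ^ (k * (n div j))\<close>, which equals \<open>1\<close> exactly when \<open>j dvd k\<close>; otherwise the geometric sum over a
  full period cancels.
\<close>
lemma sum_root_powers_over_multiples: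
  assumes "n \<ge> 1" and "primitive_root_of_unity n \<omega>" and "j dvd n"
  shows "(\<Sum>i | i < n \<and> n div j dvd i. \<omega> ^ (k * i)) = (if j dvd k then of_nat j else 0)"
proof -
  obtain q where q: "n = j * q" using assms(3) by blast
  with assms(1) have j: "j > 0" and "q > 0" by auto
  with q have div: "n div j = q" by simp
  define \<zeta> where "\<zeta> = \<omega> ^ (k * q)"
  have "(\<Sum>i | i < n \<and> n div j dvd i. \<omega> ^ (k * i)) = (\<Sum>t<j. \<omega> ^ (k * (t * q)))"
    using \<open>q > 0\<close> unfolding multiples_below[OF assms(1,3)] unfolding div
    by (subst sum.reindex) (auto simp: inj_on_def)
  also have "\<dots> = (\<Sum>t<j. \<zeta> ^ t)"
    by (simp add: \<zeta>_def mult_ac flip: power_mult)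
  also have "\<dots> = (if j dvd k then of_nat j else 0)"
  proof -
    have one: "\<zeta> = 1 \<longleftrightarrow> j dvd k"
      unfolding \<zeta>_def primitive_root_power_eq_1_iff[OF assms(1,2)] using q \<open>q > 0\<close> by simp
    have "\<zeta> ^ j = 1"
      unfolding \<zeta>_def power_mult[symmetric] primitive_root_power_eq_1_iff[OF assms(1,2)]
      using q by (simp add: mult_ac)
    then show ?thesis using one by (cases "j dvd k") (simp_all add: geometric_sum)
  qed
  finally show ?thesis .
qed

section \<open>The universal cone as an orthant\<close>

definition universal_mat :: "nat \<Rightarrow> (nat \<Rightarrow> real) \<Rightarrow> real mat" where
  "universal_mat n K =
     mat n n (\<lambda>(i, j). if Suc j dvd n \<and> n div Suc j dvd i then K (Suc j) else 0)"

lemma universal_mat_carrier [simp]: "universal_mat n K \<in> carrier_mat n n"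
  by (simp add: universal_mat_def)

lemma entry_universal_mat:
  assumes "i < n" and "j \<in> {1..n}"
  shows "entry (universal_mat n K) i j = (if j dvd n \<and> n div j dvd i then K j else 0)"
  using assms by (auto simp: entry_def universal_mat_def)

lemma mat_eq_entryI:
  assumes "A \<in> carrier_mat n n" and "B \<in> carrier_mat n n"
    and eq: "\<And>i j. i < n \<Longrightarrow> j \<in> {1..n} \<Longrightarrow> entry A i j = entry B i j"
  shows "A = B"
proof (rule eq_matI)
  fix i j assume "i < dim_row B" "j < dim_col B"
  then show "A $$ (i, j) = B $$ (i, j)" using assms(2) eq[of i "Suc j"] by (simp add: entry_def)
qed (use assms in auto)

text \<open>Row \<open>0\<close> displays all the constants, since \<open>n div j\<close> always divides \<open>0\<close>.\<close>
lemma universal_mat_eq_iff: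
  assumes "n \<ge> 1"
  shows "universal_mat n K = universal_mat n L \<longleftrightarrow> (\<forall>j. j dvd n \<longrightarrow> K j = L j)"
proof
  assume eq: "universal_mat n K = universal_mat n L"
  show "\<forall>j. j dvd n \<longrightarrow> K j = L j"
  proof (intro allI impI)
    fix j assume "j dvd n"
    then have "j \<in> {1..n}" using assms by (auto dest: dvd_imp_le intro: Suc_leI dvd_pos_nat)
    then show "K j = L j"
      using entry_universal_mat[of 0 n j K] entry_universal_mat[of 0 n j L] eq \<open>j dvd n\<close> assms
      by simp
  qed
qed (auto simp: universal_mat_def)

lemma universal_mat_add:
  "universal_mat n K + universal_mat n L = universal_mat n (\<lambda>j. K j + L j)"
  by (rule eq_matI) (auto simp: universal_mat_def)

lemma universal_mat_smult: "a \<cdot>\<^sub>m universal_mat n K = universal_mat n (\<lambda>j. a * K j)"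
  by (rule eq_matI) (auto simp: universal_mat_def)

lemma universal_mat_zero: "0\<^sub>m n n = universal_mat n (\<lambda>_. 0)"
  by (rule eq_matI) (auto simp: universal_mat_def)

lemma r_mat_eq_universal_mat:
  assumes "n \<ge> 1" and "c dvd n"
  shows "r_mat n c = universal_mat n (\<lambda>j. if j = c then 1 else 0)"
  using assms by (intro eq_matI) (auto simp: r_mat_def universal_mat_def M_set_eq_multiples)

text \<open>
  The CSP identity for \<open>k = n\<close> equates the sum of all the entries with the sum over the columns
  indexed by divisors; the difference is a sum of nonnegative terms.
\<close>
lemma CSP_nondivisor_column_zero:
  assumes "n \<ge> 1" and "primitive_root_of_unity n \<omega>" and A: "A \<in> CSP \<omega> n"
    and "i < n" and "j \<in> {1..n}" and "\<not> j dvd n"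
  shows "entry A i j = 0"
proof -
  have nonneg: "entry A i j \<ge> 0" if "i < n" "j \<in> {1..n}" for i j
    using A that unfolding CSP_def by blast
  have "\<omega> ^ (n * i) = 1" for i
    using primitive_root_power_eq_1_iff[OF assms(1,2)] by simp
  moreover have "(\<Sum>i<n. \<Sum>j\<in>{1..n}. complex_of_real (entry A i j) * \<omega> ^ (n * i)) =
      complex_of_real (\<Sum>i<n. \<Sum>j\<in>{j\<in>{1..n}. j dvd n}. entry A i j)"
    using A assms(1) unfolding CSP_def by fastforce
  ultimately have "complex_of_real (\<Sum>i<n. \<Sum>j\<in>{1..n}. entry A i j) =
      complex_of_real (\<Sum>i<n. \<Sum>j\<in>{j\<in>{1..n}. j dvd n}. entry A i j)"
    by simp
  then have eq: "(\<Sum>i<n. \<Sum>j\<in>{1..n}. entry A i j) = (\<Sum>i<n. \<Sum>j\<in>{j\<in>{1..n}. j dvd n}. entry A i j)"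
    unfolding of_real_eq_iff .
  have "(\<Sum>j\<in>{1..n}. entry A i j) =
      (\<Sum>j\<in>{j\<in>{1..n}. j dvd n}. entry A i j) + (\<Sum>j\<in>{j\<in>{1..n}. \<not> j dvd n}. entry A i j)" for i
    by (subst sum.union_disjoint[symmetric]) (auto intro: sum.cong)
  with eq have "(\<Sum>i<n. \<Sum>j\<in>{j\<in>{1..n}. \<not> j dvd n}. entry A i j) = 0"
    by (simp add: sum.distrib)
  then have "(\<Sum>j\<in>{j\<in>{1..n}. \<not> j dvd n}. entry A i j) = 0"
    using assms(4) by (subst (asm) sum_nonneg_eq_0_iff) (auto intro!: sum_nonneg nonneg)
  then show ?thesis
    using assms(4-6) by (subst (asm) sum_nonneg_eq_0_iff) (auto intro!: nonneg)
qed

lemma universal_mat_in_CSP: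
  assumes "n \<ge> 1" and "primitive_root_of_unity n \<omega>" and K: "\<And>j. j dvd n \<Longrightarrow> K j \<ge> 0"
  shows "universal_mat n K \<in> CSP \<omega> n"
proof -
  let ?A = "universal_mat n K"
  have "(\<Sum>i<n. \<Sum>j\<in>{1..n}. complex_of_real (entry ?A i j) * \<omega> ^ (k * i)) =
        complex_of_real (\<Sum>i<n. \<Sum>j\<in>{j\<in>{1..n}. j dvd k}. entry ?A i j)" for k
  proof -
    have column: "(\<Sum>i<n. complex_of_real (entry ?A i j) * \<omega> ^ (m * i)) =
        (if j dvd n \<and> j dvd m then complex_of_real (K j) * of_nat j else 0)"
      if j: "j \<in> {1..n}" for j m
    proof (cases "j dvd n")
      case True
      have "(\<Sum>i<n. complex_of_real (entry ?A i j) * \<omega> ^ (m * i)) =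
          (\<Sum>i<n. if n div j dvd i then complex_of_real (K j) * \<omega> ^ (m * i) else 0)"
        using j True by (intro sum.cong) (auto simp: entry_universal_mat)
      also have "\<dots> = (\<Sum>i | i < n \<and> n div j dvd i. complex_of_real (K j) * \<omega> ^ (m * i))"
        by (subst sum.inter_filter[symmetric]) auto
      also have "\<dots> = complex_of_real (K j) * (if j dvd m then of_nat j else 0)"
        unfolding sum_distrib_left[symmetric]
        by (simp only: sum_root_powers_over_multiples[OF assms(1,2) True])
      finally show ?thesis using True by simp
    next
      case False
      then show ?thesis using j by (simp add: entry_universal_mat)
    qed
    \<comment> \<open>The unweighted column sums on the right-hand side are the case \<open>m = 0\<close>.\<close>
    have "complex_of_real (\<Sum>i<n. \<Sum>j\<in>{j\<in>{1..n}. j dvd k}. entry ?A i j) =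
        (\<Sum>j\<in>{j\<in>{1..n}. j dvd k}. \<Sum>i<n. complex_of_real (entry ?A i j) * \<omega> ^ (0 * i))"
      by (subst sum.swap) simp
    also have "\<dots> = (\<Sum>j\<in>{j\<in>{1..n}. j dvd k}.
        if j dvd n \<and> j dvd 0 then complex_of_real (K j) * of_nat j else 0)"
      by (intro sum.cong refl column) auto
    also have "\<dots> = (\<Sum>j\<in>{1..n}. if j dvd n \<and> j dvd k then complex_of_real (K j) * of_nat j else 0)"
      by (subst sum.inter_filter) (auto intro!: sum.cong)
    also have "\<dots> = (\<Sum>j\<in>{1..n}. \<Sum>i<n. complex_of_real (entry ?A i j) * \<omega> ^ (k * i))"
      by (intro sum.cong refl column[symmetric])
    also have "\<dots> = (\<Sum>i<n. \<Sum>j\<in>{1..n}. complex_of_real (entry ?A i j) * \<omega> ^ (k * i))"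
      by (rule sum.swap)
    finally show ?thesis ..
  qed
  then show ?thesis using K by (auto simp: CSP_def entry_universal_mat)
qed

lemma universal_mat_in_universal_CSP:
  assumes "n \<ge> 1" and "primitive_root_of_unity n \<omega>" and K: "\<And>j. j dvd n \<Longrightarrow> K j \<ge> 0"
  shows "universal_mat n K \<in> universal_CSP \<omega> n"
proof -
  \<comment> \<open>The definition asks for nonnegative constants also at non-divisors, where \<open>K\<close> may be negative.\<close>
  have "\<exists>L. (\<forall>j\<in>{1..n}. L j \<ge> 0) \<and> (\<forall>i<n. \<forall>j\<in>{1..n}. j dvd n \<longrightarrow>
      entry (universal_mat n K) i j = (if n div j dvd i then L j else 0))"
    by (rule exI[of _ "\<lambda>j. if j dvd n then K j else 0"]) (auto simp: K entry_universal_mat)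
  then show ?thesis using universal_mat_in_CSP[OF assms] by (simp add: universal_CSP_def)
qed

lemma universal_CSP_iff:
  assumes "n \<ge> 1" and "primitive_root_of_unity n \<omega>"
  shows "A \<in> universal_CSP \<omega> n \<longleftrightarrow> (\<exists>K. (\<forall>j. j dvd n \<longrightarrow> K j \<ge> 0) \<and> A = universal_mat n K)"
proof
  assume "A \<in> universal_CSP \<omega> n"
  then obtain K where A: "A \<in> CSP \<omega> n" and K: "\<forall>j\<in>{1..n}. K j \<ge> 0"
    and entries: "\<forall>i<n. \<forall>j\<in>{1..n}. j dvd n \<longrightarrow> entry A i j = (if n div j dvd i then K j else 0)"
    unfolding universal_CSP_def by blast
  have "A = universal_mat n K"
  proof (rule mat_eq_entryI)
    show "A \<in> carrier_mat n n" using A by (simp add: CSP_def)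
    show "entry A i j = entry (universal_mat n K) i j" if "i < n" "j \<in> {1..n}" for i j
      using entries CSP_nondivisor_column_zero[OF assms A that] that
      by (cases "j dvd n") (simp_all add: entry_universal_mat)
  qed simp
  moreover have "K j \<ge> 0" if "j dvd n" for j
    using K that assms(1) by (auto dest: dvd_imp_le intro: Suc_leI dvd_pos_nat)
  ultimately show "\<exists>K. (\<forall>j. j dvd n \<longrightarrow> K j \<ge> 0) \<and> A = universal_mat n K" by blast
next
  assume "\<exists>K. (\<forall>j. j dvd n \<longrightarrow> K j \<ge> 0) \<and> A = universal_mat n K"
  then show "A \<in> universal_CSP \<omega> n" using universal_mat_in_universal_CSP[OF assms] by blast
qed

section \<open>Extreme rays\<close>

text \<open>
  Splitting off one positive coordinate \<open>K j\<close> decomposes \<open>X\<close> within the orthant; extremality makes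
  that part a multiple of \<open>X\<close>, and the coordinate \<open>j\<close> shows that the multiple is \<open>X\<close> itself.
\<close>
lemma extreme_ray_imp_axis:
  assumes "n \<ge> 1" and "primitive_root_of_unity n \<omega>" and X: "extreme_ray (universal_CSP \<omega> n) X"
  shows "\<exists>a j. a > 0 \<and> j dvd n \<and> X = a \<cdot>\<^sub>m r_mat n j"
proof -
  obtain K where K: "\<And>j. j dvd n \<Longrightarrow> K j \<ge> 0" and XK: "X = universal_mat n K"
    using X universal_CSP_iff[OF assms(1,2)] unfolding extreme_ray_def by blast
  have "X \<noteq> 0\<^sub>m n n" using X unfolding extreme_ray_def XK by (simp add: universal_mat_def)
  then obtain j where j: "j dvd n" "K j \<noteq> 0"
    unfolding XK universal_mat_zero universal_mat_eq_iff[OF assms(1)] by blast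
  then have pos: "K j > 0" using K[of j] by simp
  define Y where "Y = universal_mat n (\<lambda>i. if i = j then K j else 0)"
  define Z where "Z = universal_mat n (\<lambda>i. if i = j then 0 else K i)"
  have "Y \<in> universal_CSP \<omega> n" "Z \<in> universal_CSP \<omega> n"
    unfolding Y_def Z_def
    using K j(1) by (auto intro!: universal_mat_in_universal_CSP[OF assms(1,2)])
  moreover have "X = Y + Z"
    unfolding XK Y_def Z_def universal_mat_add universal_mat_eq_iff[OF assms(1)] by simp
  ultimately obtain s where s: "Y = s \<cdot>\<^sub>m X"
    using X unfolding extreme_ray_def by blast
  then have s_coords: "\<And>i. i dvd n \<Longrightarrow> (if i = j then K j else 0) = s * K i"
    unfolding XK Y_def universal_mat_smult universal_mat_eq_iff[OF assms(1)] by blast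
  then have "s = 1" using s_coords[OF j(1)] pos by simp
  then have "K i = 0" if "i dvd n" "i \<noteq> j" for i
    using s_coords[OF that(1)] that(2) by simp
  then have "X = K j \<cdot>\<^sub>m r_mat n j"
    unfolding XK r_mat_eq_universal_mat[OF assms(1) j(1)] universal_mat_smult
      universal_mat_eq_iff[OF assms(1)]
    by simp
  then show ?thesis using pos j(1) by blast
qed

text \<open>
  If \<open>K j + L j = 0\<close> with both terms nonnegative, then both vanish; so in every decomposition of a
  point on an axis, both summands lie on that axis.
\<close>
lemma axis_extreme_ray:
  assumes "n \<ge> 1" and "primitive_root_of_unity n \<omega>" and "a > 0" and "c dvd n"
  shows "extreme_ray (universal_CSP \<omega> n) (a \<cdot>\<^sub>m r_mat n c)"
proof -
  let ?X = "a \<cdot>\<^sub>m r_mat n c"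
  note eq_iff = universal_mat_eq_iff[OF assms(1)]
  have X: "?X = universal_mat n (\<lambda>j. if j = c then a else 0)"
    unfolding r_mat_eq_universal_mat[OF assms(1,4)] universal_mat_smult eq_iff by simp
  have "?X \<in> universal_CSP \<omega> n"
    unfolding X using assms(3) by (intro universal_mat_in_universal_CSP[OF assms(1,2)]) simp
  moreover have "?X \<noteq> 0\<^sub>m n n"
    unfolding X universal_mat_zero eq_iff using assms(3,4) by auto
  moreover have "(\<exists>s\<ge>0. Y = s \<cdot>\<^sub>m ?X) \<and> (\<exists>t\<ge>0. Z = t \<cdot>\<^sub>m ?X)"
    if YZ: "Y \<in> universal_CSP \<omega> n" "Z \<in> universal_CSP \<omega> n" and sum: "?X = Y + Z" for Y Z
  proof -
    obtain K L where K: "\<And>j. j dvd n \<Longrightarrow> K j \<ge> 0" and Y: "Y = universal_mat n K"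
      and L: "\<And>j. j dvd n \<Longrightarrow> L j \<ge> 0" and Z: "Z = universal_mat n L"
      using YZ unfolding universal_CSP_iff[OF assms(1,2)] by blast
    have coords: "(if j = c then a else 0) = K j + L j" if "j dvd n" for j
      using sum that unfolding X Y Z universal_mat_add eq_iff by blast
    have "K j = 0 \<and> L j = 0" if "j dvd n" "j \<noteq> c" for j
      using coords[OF that(1)] K[OF that(1)] L[OF that(1)] that(2) by simp
    then have "Y = (K c / a) \<cdot>\<^sub>m ?X" and "Z = (L c / a) \<cdot>\<^sub>m ?X"
      unfolding Y Z X universal_mat_smult eq_iff using assms(3) by auto
    moreover have "K c / a \<ge> 0" "L c / a \<ge> 0" using K L assms(3,4) by auto
    ultimately show ?thesis by blast
  qed
  moreover have "dim_row ?X = n" "dim_col ?X = n" by (simp_all add: r_mat_def)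
  ultimately show ?thesis unfolding extreme_ray_def by simp
qed

theorem corollary7p4:
  fixes n d :: nat and \<omega> :: complex and c :: "nat \<Rightarrow> nat"
  assumes "n \<ge> 1"
    and "primitive_root_of_unity n \<omega>"
    and "strict_mono_on {1..d} c"
    and "c ` {1..d} = {k. k dvd n}"
    and "c 1 = 1" and "c d = n"
  shows "{X. extreme_ray (universal_CSP \<omega> n) X} =
         {a \<cdot>\<^sub>m r_mat n (c l) | a l. a > 0 \<and> l \<in> {1..d}}"
proof (intro subset_antisym subsetI)
  fix X assume "X \<in> {X. extreme_ray (universal_CSP \<omega> n) X}"
  then obtain a j where "a > 0" "j dvd n" "X = a \<cdot>\<^sub>m r_mat n j"
    using extreme_ray_imp_axis[OF assms(1,2)] by blast
  moreover from this obtain l where "l \<in> {1..d}" "j = c l" using assms(4) by blast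
  ultimately show "X \<in> {a \<cdot>\<^sub>m r_mat n (c l) | a l. a > 0 \<and> l \<in> {1..d}}" by blast
next
  fix X assume "X \<in> {a \<cdot>\<^sub>m r_mat n (c l) | a l. a > 0 \<and> l \<in> {1..d}}"
  then obtain a l where "a > 0" "l \<in> {1..d}" "X = a \<cdot>\<^sub>m r_mat n (c l)" by blast
  moreover from this have "c l dvd n" using assms(4) by blast
  ultimately show "X \<in> {X. extreme_ray (universal_CSP \<omega> n) X}"
    using axis_extreme_ray[OF assms(1,2)] by simp
qed

end
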